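(* Let $\{Y_v\}_{v\in V}$ be real-valued random variables having a dependency graph $G=(V,E)$, where $V$ is finite. For every $v\in V$ let $\sigma_v^2 := \mathrm{Var}(Y_v)$ and assume further that $Y_v\leq 1$ and $\mathbb{E}[Y_v]=0$. Set $S=\sum_{v\in V} \sigma_{v}^{2}$, assume $0<S<\infty$, and fix $t>0$. Then \[ \mathbb{P}\left[\sum_{v\in V} Y_v \geq t \right] \leq \exp\left(-\frac{S}{\chi^{*}(G)}\, \psi\left(\frac{t}{S}\right) \right), \] where $\psi(x) = (1+x)\ln(1+x)- x$ and $\chi^*(G)$ is the fractional chromatic number of $G$.
   Context: Dependency graph: a dependency graph for random variables $\{Y_v\}_{v\in V}$ indexed by a finite set $V$ is any loopless graph $G=(V,E)$ with vertex set $V$ such that, whenever $V'\subseteq V$ and $v\in V\setminus V'$ is not adjacent to any vertex of $V'$, the random variable $Y_v$ is mutually independent of the family $\{Y_{v'}\}_{v'\in V'}$ (i.e. $Y_v$ is independent of the $\sigma$-algebra generated by this family). Fractional chromatic number: a $b$-fold coloring of $G$ is an assignment of sets (of colors) of size $b$ to the vertices of $G$ such that adjacent vertices have disjoint sets. $G$ is $(a:b)$-colorable if it has a $b$-fold coloring using $a$ different colors; the $b$-fold chromatic number $\chi_b(G)$ is the least $a$ for which $G$ is $(a:b)$-colorable. The fractional chromatic number is $\chi^*(G)=\inf_{b\ge 1}\frac{\chi_b(G)}{b}$, the infimum being over positive integers $b$. *)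

theory Defs
  imports "HOL-Probability.Probability"
begin

text \<open>A loopless (undirected, simple) graph is given by its vertex set \<open>V\<close> and a set \<open>E\<close> of
  two-element subsets of \<open>V\<close>; vertices \<open>u\<close> and \<open>v\<close> are adjacent iff \<open>{u, v} \<in> E\<close>.\<close>

definition loopless_graph :: "'v set \<Rightarrow> 'v set set \<Rightarrow> bool" where
  "loopless_graph V E \<longleftrightarrow> (\<forall>e\<in>E. \<exists>u\<in>V. \<exists>v\<in>V. u \<noteq> v \<and> e = {u, v})"

definition generated_sigma :: "'w measure \<Rightarrow> ('v \<Rightarrow> 'w \<Rightarrow> real) \<Rightarrow> 'v set \<Rightarrow> 'w set set" where
  "generated_sigma M Y I =
     sigma_sets (space M) (\<Union>i\<in>I. {Y i -` A \<inter> space M | A. A \<in> sets borel})"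

definition dependency_graph ::
    "'w measure \<Rightarrow> 'v set \<Rightarrow> 'v set set \<Rightarrow> ('v \<Rightarrow> 'w \<Rightarrow> real) \<Rightarrow> bool" where
  "dependency_graph M V E Y \<longleftrightarrow>
     loopless_graph V E \<and>
     (\<forall>V' v. V' \<subseteq> V \<longrightarrow> v \<in> V - V' \<longrightarrow> (\<forall>u\<in>V'. {u, v} \<notin> E) \<longrightarrow>
        prob_space.indep_set M (generated_sigma M Y {v}) (generated_sigma M Y V'))"

definition fold_coloring ::
    "'v set \<Rightarrow> 'v set set \<Rightarrow> nat \<Rightarrow> ('v \<Rightarrow> nat set) \<Rightarrow> bool" where
  "fold_coloring V E b c \<longleftrightarrow>
     (\<forall>v\<in>V. finite (c v) \<and> card (c v) = b) \<and>
     (\<forall>u\<in>V. \<forall>v\<in>V. {u, v} \<in> E \<longrightarrow> c u \<inter> c v = {})"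

definition fold_colorable :: "'v set \<Rightarrow> 'v set set \<Rightarrow> nat \<Rightarrow> nat \<Rightarrow> bool" where
  "fold_colorable V E a b \<longleftrightarrow>
     (\<exists>c. fold_coloring V E b c \<and> card (\<Union>v\<in>V. c v) = a)"

definition fold_chromatic_number :: "'v set \<Rightarrow> 'v set set \<Rightarrow> nat \<Rightarrow> nat" where
  "fold_chromatic_number V E b = (LEAST a. fold_colorable V E a b)"

definition fractional_chromatic_number :: "'v set \<Rightarrow> 'v set set \<Rightarrow> real" where
  "fractional_chromatic_number V E =
     (INF b\<in>{1..}. real (fold_chromatic_number V E b) / real b)"

definition psi :: "real \<Rightarrow> real" where
  "psi x = (1 + x) * ln (1 + x) - x"

end

theory Submission
  imports Defs
begin

text \<open>The proof combines Bennett's exponential moment bound with Janson's use of fractional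
  colorings.

  A single centered variable \<open>Y \<le> 1\<close> satisfies
  \<open>\<E>[exp (u Y)] \<le> exp ((exp u - 1 - u) \<sigma>\<^sup>2)\<close> (\<open>bennett_mgf\<close>), and along a set of pairwise
  non-adjacent vertices these bounds multiply, since such variables are independent
  (\<open>bennett_mgf_nonadjacent\<close>).

  Now take a \<open>b\<close>-fold coloring with \<open>a\<close> colors. Every color class consists of pairwise
  non-adjacent vertices, and every vertex lies in exactly \<open>b\<close> classes. Hence \<open>b / a\<close> times the
  whole sum is the average of the \<open>a\<close> sums over the color classes, and convexity of \<open>exp\<close>
  bounds its exponential by an average of exponentials, each of which is a product of independent
  factors. If one centers the exponent of each class by its own bound before averaging, the
  variances of the classes average out as well, which replaces a use of Hoelder's
  inequality:
  \<open>\<E>[exp (u b/a \<Sum>Y)] \<le> exp (b/a (exp u - 1 - u) S)\<close> (\<open>bennett_mgf_fold_coloring\<close>).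

  Markov's inequality with Bennett's choice \<open>u = ln (1 + t/S)\<close> yields the tail bound with \<open>a / b\<close>
  in place of \<open>\<chi>\<^sup>*\<close>. It remains to take the infimum over \<open>b\<close>; this needs that \<open>\<chi>\<^sub>b\<close> is attained by
  a coloring and that \<open>\<chi>\<^sub>b \<ge> b\<close>, so that \<open>\<chi>\<^sup>*\<close> is positive.\<close>

section \<open>Exponential moments of a bounded centered variable\<close>

text \<open>For fixed \<open>y\<close>, the difference of the two sides and its derivative in \<open>u\<close> both vanish at
  \<open>u = 0\<close>, and its second derivative is \<open>y\<^sup>2 (exp u - exp (u y)) \<ge> 0\<close>.\<close>

lemma exp_mult_le_quadratic:
  fixes u y :: real
  assumes "0 \<le> u" and "y \<le> 1"
  shows "exp (u * y) \<le> 1 + u * y + (exp u - 1 - u) * y\<^sup>2"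
proof -
  define f where "f x = (exp x - 1 - x) * y\<^sup>2 - (exp (x * y) - 1 - x * y)" for x
  define f' where "f' x = (exp x - 1) * y\<^sup>2 - (y * exp (x * y) - y)" for x
  have f'_nonneg: "0 \<le> f' x" if "0 \<le> x" for x
  proof -
    have "f' 0 \<le> f' x"
    proof (rule DERIV_nonneg_imp_nondecreasing[OF that])
      fix z :: real assume "0 \<le> z" "z \<le> x"
      have "(f' has_real_derivative y\<^sup>2 * (exp z - exp (z * y))) (at z)"
        unfolding f'_def
        by (auto intro!: derivative_eq_intros simp: algebra_simps power2_eq_square)
      moreover have "z * y \<le> z"
        using \<open>0 \<le> z\<close> \<open>y \<le> 1\<close> by (simp add: mult_left_le)
      then have "0 \<le> y\<^sup>2 * (exp z - exp (z * y))"
        by simp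
      ultimately show "\<exists>d. (f' has_real_derivative d) (at z) \<and> 0 \<le> d"
        by blast
    qed
    then show ?thesis by (simp add: f'_def)
  qed
  have "f 0 \<le> f u"
  proof (rule DERIV_nonneg_imp_nondecreasing[OF \<open>0 \<le> u\<close>])
    fix z :: real assume "0 \<le> z" "z \<le> u"
    have "(f has_real_derivative f' z) (at z)"
      unfolding f_def f'_def
      by (auto intro!: derivative_eq_intros simp: algebra_simps power2_eq_square)
    with f'_nonneg[OF \<open>0 \<le> z\<close>] show "\<exists>d. (f has_real_derivative d) (at z) \<and> 0 \<le> d"
      by blast
  qed
  then show ?thesis by (simp add: f_def)
qed

lemma (in prob_space) integrable_exp_bounded_above:
  fixes X :: "'a \<Rightarrow> real"
  assumes "X \<in> borel_measurable M" and "AE \<omega> in M. X \<omega> \<le> B" and "0 \<le> u"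
  shows "integrable M (\<lambda>\<omega>. exp (u * X \<omega>))"
proof (rule integrable_const_bound[where B = "exp (u * B)"])
  show "AE \<omega> in M. norm (exp (u * X \<omega>)) \<le> exp (u * B)"
    using assms(2) by eventually_elim (use \<open>0 \<le> u\<close> in \<open>simp add: mult_left_mono\<close>)
qed (use assms(1) in measurable)

lemma (in prob_space) bennett_mgf:
  fixes X :: "'a \<Rightarrow> real"
  assumes "X \<in> borel_measurable M" and "AE \<omega> in M. X \<omega> \<le> 1"
    and "integrable M X" and "expectation X = 0"
    and "integrable M (\<lambda>\<omega>. (X \<omega>)\<^sup>2)" and "0 \<le> u"
  shows "expectation (\<lambda>\<omega>. exp (u * X \<omega>))
    \<le> exp ((exp u - 1 - u) * expectation (\<lambda>\<omega>. (X \<omega>)\<^sup>2))"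
proof -
  have "expectation (\<lambda>\<omega>. exp (u * X \<omega>))
      \<le> expectation (\<lambda>\<omega>. 1 + u * X \<omega> + (exp u - 1 - u) * (X \<omega>)\<^sup>2)"
  proof (rule integral_mono_AE)
    show "integrable M (\<lambda>\<omega>. exp (u * X \<omega>))"
      using assms by (intro integrable_exp_bounded_above[where B = 1])
    show "integrable M (\<lambda>\<omega>. 1 + u * X \<omega> + (exp u - 1 - u) * (X \<omega>)\<^sup>2)"
      using assms by (intro Bochner_Integration.integrable_add integrable_mult_right) auto
    show "AE \<omega> in M. exp (u * X \<omega>) \<le> 1 + u * X \<omega> + (exp u - 1 - u) * (X \<omega>)\<^sup>2"
      using assms(2) by eventually_elim (use \<open>0 \<le> u\<close> in \<open>rule exp_mult_le_quadratic\<close>)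
  qed
  also have "\<dots> = 1 + (exp u - 1 - u) * expectation (\<lambda>\<omega>. (X \<omega>)\<^sup>2)"
    using assms by (simp add: prob_space)
  also have "\<dots> \<le> exp ((exp u - 1 - u) * expectation (\<lambda>\<omega>. (X \<omega>)\<^sup>2))"
    by (rule exp_ge_add_one_self)
  finally show ?thesis .
qed

section \<open>Sums over pairwise non-adjacent vertices\<close>

lemma sum_measurable_generated_sigma:
  fixes Y :: "'v \<Rightarrow> 'w \<Rightarrow> real"
  assumes "B \<in> sets borel"
  shows "(\<lambda>\<omega>. \<Sum>v\<in>I. Y v \<omega>) -` B \<inter> space M \<in> generated_sigma M Y I"
proof -
  define G where "G = (\<Union>i\<in>I. {Y i -` A \<inter> space M | A. A \<in> sets borel})"
  have G: "G \<subseteq> Pow (space M)" by (auto simp: G_def)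
  have "Y v \<in> borel_measurable (sigma (space M) G)" if "v \<in> I" for v
  proof (rule measurableI)
    fix A :: "real set" assume "A \<in> sets borel"
    with \<open>v \<in> I\<close> have "Y v -` A \<inter> space M \<in> G" by (auto simp: G_def)
    then show "Y v -` A \<inter> space (sigma (space M) G) \<in> sets (sigma (space M) G)"
      using G by (simp add: space_measure_of)
  qed simp
  then have "(\<lambda>\<omega>. \<Sum>v\<in>I. Y v \<omega>) \<in> borel_measurable (sigma (space M) G)"
    by (intro borel_measurable_sum)
  from measurable_sets[OF this assms] show ?thesis
    using G by (simp add: generated_sigma_def G_def)
qed

lemma (in prob_space) indep_var_sum_nonadjacent:
  fixes Y :: "'v \<Rightarrow> 'a \<Rightarrow> real"
  assumes dep: "dependency_graph M V E Y"
    and meas: "\<And>v. v \<in> V \<Longrightarrow> Y v \<in> borel_measurable M"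
    and "A \<subseteq> V" and "v \<in> V - A" and "\<And>u. u \<in> A \<Longrightarrow> {u, v} \<notin> E"
  shows "indep_var borel (Y v) borel (\<lambda>\<omega>. \<Sum>w\<in>A. Y w \<omega>)"
proof -
  have "indep_set (generated_sigma M Y {v}) (generated_sigma M Y A)"
    using dep assms(3-5) by (simp add: dependency_graph_def)
  moreover have "sigma_sets (space M) {Y v -` B \<inter> space M | B. B \<in> sets borel}
      \<subseteq> generated_sigma M Y {v}"
    by (simp add: generated_sigma_def)
  moreover have "sigma_sets (space M) {(\<lambda>\<omega>. \<Sum>w\<in>A. Y w \<omega>) -` B \<inter> space M | B. B \<in> sets borel}
      \<subseteq> generated_sigma M Y A"
    using sum_measurable_generated_sigma[of _ Y A M]
    unfolding generated_sigma_def by (intro sigma_sets_mono) blast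
  ultimately have "indep_set
      (sigma_sets (space M) {Y v -` B \<inter> space M | B. B \<in> sets borel})
      (sigma_sets (space M) {(\<lambda>\<omega>. \<Sum>w\<in>A. Y w \<omega>) -` B \<inter> space M | B. B \<in> sets borel})"
    unfolding indep_set_def
    by (elim indep_sets_mono_sets) (auto split: bool.splits)
  moreover have "(\<lambda>\<omega>. \<Sum>w\<in>A. Y w \<omega>) \<in> borel_measurable M"
    using meas \<open>A \<subseteq> V\<close> by (intro borel_measurable_sum) auto
  ultimately show ?thesis
    using meas \<open>v \<in> V - A\<close> by (simp add: indep_var_eq)
qed

lemma AE_sum_le_card:
  fixes Y :: "'v \<Rightarrow> 'w \<Rightarrow> real"
  assumes "finite A" and "\<And>v. v \<in> A \<Longrightarrow> AE \<omega> in M. Y v \<omega> \<le> 1"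
  shows "AE \<omega> in M. (\<Sum>v\<in>A. Y v \<omega>) \<le> real (card A)"
proof -
  have "AE \<omega> in M. \<forall>v\<in>A. Y v \<omega> \<le> 1"
    using assms by (intro AE_finite_allI)
  then show ?thesis
  proof eventually_elim
    case (elim \<omega>)
    then show ?case using sum_bounded_above[of A "\<lambda>v. Y v \<omega>" 1] by simp
  qed
qed

locale bennett_family = prob_space M
  for M :: "'w measure" +
  fixes V :: "'v set" and E :: "'v set set" and Y :: "'v \<Rightarrow> 'w \<Rightarrow> real"
  assumes finite_V: "finite V"
    and meas: "\<And>v. v \<in> V \<Longrightarrow> Y v \<in> borel_measurable M"
    and dep: "dependency_graph M V E Y"
    and le_one: "\<And>v. v \<in> V \<Longrightarrow> AE \<omega> in M. Y v \<omega> \<le> 1"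
    and int: "\<And>v. v \<in> V \<Longrightarrow> integrable M (Y v)"
    and centered: "\<And>v. v \<in> V \<Longrightarrow> expectation (Y v) = 0"
    and sq_int: "\<And>v. v \<in> V \<Longrightarrow> integrable M (\<lambda>\<omega>. (Y v \<omega>)\<^sup>2)"
begin

lemma integrable_exp_sum:
  assumes "A \<subseteq> V" and "0 \<le> u"
  shows "integrable M (\<lambda>\<omega>. exp (u * (\<Sum>v\<in>A. Y v \<omega>)))"
proof (rule integrable_exp_bounded_above)
  show "(\<lambda>\<omega>. \<Sum>v\<in>A. Y v \<omega>) \<in> borel_measurable M"
    using meas assms(1) by (intro borel_measurable_sum) auto
  show "AE \<omega> in M. (\<Sum>v\<in>A. Y v \<omega>) \<le> real (card A)"
    using assms(1) finite_V le_one by (intro AE_sum_le_card) (auto intro: finite_subset)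
qed fact

text \<open>The dependency graph only provides independence of one vertex from a set that it is not
  adjacent to; adding the vertices one at a time, this is enough to factor the expectation.\<close>

lemma bennett_mgf_nonadjacent:
  assumes "A \<subseteq> V" and "\<And>v w. v \<in> A \<Longrightarrow> w \<in> A \<Longrightarrow> {v, w} \<notin> E" and "0 \<le> u"
  shows "expectation (\<lambda>\<omega>. exp (u * (\<Sum>v\<in>A. Y v \<omega>)))
    \<le> exp ((exp u - 1 - u) * (\<Sum>v\<in>A. expectation (\<lambda>\<omega>. (Y v \<omega>)\<^sup>2)))"
proof -
  have "finite A" using assms(1) finite_V by (rule finite_subset)
  then show ?thesis
    using assms(1,2)
  proof (induction A rule: finite_induct)
    case empty
    then show ?case by (simp add: prob_space)
  next
    case (insert v A)
    then have v: "v \<in> V - A" and A: "A \<subseteq> V" by auto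
    have "indep_var borel (Y v) borel (\<lambda>\<omega>. \<Sum>w\<in>A. Y w \<omega>)"
      using dep meas A v insert.prems(2)
      by (intro indep_var_sum_nonadjacent[of V E]) auto
    from indep_var_compose[OF this, of "\<lambda>x. exp (u * x)" borel "\<lambda>x. exp (u * x)" borel]
    have indep: "indep_var borel (\<lambda>\<omega>. exp (u * Y v \<omega>)) borel (\<lambda>\<omega>. exp (u * (\<Sum>w\<in>A. Y w \<omega>)))"
      by (simp add: comp_def)
    have "expectation (\<lambda>\<omega>. exp (u * (\<Sum>w\<in>insert v A. Y w \<omega>)))
        = expectation (\<lambda>\<omega>. exp (u * Y v \<omega>) * exp (u * (\<Sum>w\<in>A. Y w \<omega>)))"
      using insert.hyps by (simp add: distrib_left exp_add)
    also have "\<dots> = expectation (\<lambda>\<omega>. exp (u * Y v \<omega>))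
        * expectation (\<lambda>\<omega>. exp (u * (\<Sum>w\<in>A. Y w \<omega>)))"
      using integrable_exp_sum[of "{v}" u] integrable_exp_sum[OF A \<open>0 \<le> u\<close>] v \<open>0 \<le> u\<close> indep
      by (intro indep_var_lebesgue_integral) auto
    also have "\<dots> \<le> exp ((exp u - 1 - u) * expectation (\<lambda>\<omega>. (Y v \<omega>)\<^sup>2))
        * exp ((exp u - 1 - u) * (\<Sum>w\<in>A. expectation (\<lambda>\<omega>. (Y w \<omega>)\<^sup>2)))"
    proof (rule mult_mono)
      show "expectation (\<lambda>\<omega>. exp (u * Y v \<omega>))
          \<le> exp ((exp u - 1 - u) * expectation (\<lambda>\<omega>. (Y v \<omega>)\<^sup>2))"
        using v meas le_one int centered sq_int \<open>0 \<le> u\<close> by (intro bennett_mgf) auto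
      show "expectation (\<lambda>\<omega>. exp (u * (\<Sum>w\<in>A. Y w \<omega>)))
          \<le> exp ((exp u - 1 - u) * (\<Sum>w\<in>A. expectation (\<lambda>\<omega>. (Y w \<omega>)\<^sup>2)))"
        using A insert.prems(2) by (intro insert.IH) auto
    qed simp_all
    also have "\<dots> = exp ((exp u - 1 - u) * (\<Sum>w\<in>insert v A. expectation (\<lambda>\<omega>. (Y w \<omega>)\<^sup>2)))"
      using insert.hyps by (simp add: distrib_left exp_add)
    finally show ?case .
  qed
qed

end

section \<open>Averaging over the color classes of a fractional coloring\<close>

lemma sum_over_color_classes:
  fixes x :: "'v \<Rightarrow> real"
  assumes "finite V" and "fold_coloring V E b c"
  shows "(\<Sum>j\<in>(\<Union>v\<in>V. c v). \<Sum>v\<in>{v\<in>V. j \<in> c v}. x v) = real b * (\<Sum>v\<in>V. x v)"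
proof -
  have fin: "finite (\<Union>v\<in>V. c v)"
    using assms by (auto simp: fold_coloring_def)
  have "(\<Sum>j\<in>(\<Union>v\<in>V. c v). \<Sum>v\<in>{v\<in>V. j \<in> c v}. x v)
      = (\<Sum>v\<in>V. \<Sum>j\<in>{j\<in>(\<Union>v\<in>V. c v). j \<in> c v}. x v)"
    by (rule sum.swap_restrict[OF fin \<open>finite V\<close>])
  also have "\<dots> = (\<Sum>v\<in>V. real b * x v)"
  proof (rule sum.cong[OF refl])
    fix v assume "v \<in> V"
    then have "{j\<in>(\<Union>v\<in>V. c v). j \<in> c v} = c v" by auto
    with \<open>v \<in> V\<close> assms(2) show "(\<Sum>j\<in>{j\<in>(\<Union>v\<in>V. c v). j \<in> c v}. x v) = real b * x v"
      by (simp add: fold_coloring_def)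
  qed
  finally show ?thesis by (simp add: sum_distrib_left)
qed

lemma exp_average_le:
  fixes x :: "'c \<Rightarrow> real"
  assumes "finite C" and "C \<noteq> {}"
  shows "exp ((\<Sum>j\<in>C. x j) / real (card C)) \<le> (\<Sum>j\<in>C. exp (x j)) / real (card C)"
proof -
  have "(\<Sum>j\<in>C. 1 / real (card C)) = 1"
    using assms by simp
  from convex_on_sum[OF assms exp_convex this, of x] show ?thesis
    by (simp flip: sum_divide_distrib)
qed

context bennett_family
begin

text \<open>Write \<open>X j\<close> for the sum over the class of color \<open>j\<close> and \<open>L j\<close> for the logarithm of its
  moment bound. Convexity applied to the centered exponents \<open>u X j - L j\<close>, each of which has
  exponential moment at most 1, gives
  \<open>exp (average of u X j - L j) \<le> average of exp (u X j - L j)\<close>, whose expectation is at most 1.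
  Both averages on the left are multiples of a sum over all of \<open>V\<close>.\<close>

lemma bennett_mgf_fold_coloring:
  assumes c: "fold_coloring V E b c" and "(\<Union>v\<in>V. c v) \<noteq> {}" and "0 \<le> u"
  defines "a \<equiv> card (\<Union>v\<in>V. c v)"
  shows "expectation (\<lambda>\<omega>. exp (u * real b / real a * (\<Sum>v\<in>V. Y v \<omega>)))
    \<le> exp (real b / real a * ((exp u - 1 - u) * (\<Sum>v\<in>V. expectation (\<lambda>\<omega>. (Y v \<omega>)\<^sup>2))))"
proof -
  define C where "C = (\<Union>v\<in>V. c v)"
  define A where "A j = {v\<in>V. j \<in> c v}" for j
  define X where "X j \<omega> = (\<Sum>v\<in>A j. Y v \<omega>)" for j \<omega>
  define L where "L j = (exp u - 1 - u) * (\<Sum>v\<in>A j. expectation (\<lambda>\<omega>. (Y v \<omega>)\<^sup>2))" for j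
  define T where "T = (exp u - 1 - u) * (\<Sum>v\<in>V. expectation (\<lambda>\<omega>. (Y v \<omega>)\<^sup>2))"
  have C: "finite C" "C \<noteq> {}"
    using assms finite_V by (auto simp: C_def fold_coloring_def)
  have a: "real a = real (card C)" and "0 < real a"
    using C by (auto simp: a_def C_def card_gt_0_iff)
  have sum_X: "(\<Sum>j\<in>C. X j \<omega>) = real b * (\<Sum>v\<in>V. Y v \<omega>)" for \<omega>
    using sum_over_color_classes[OF finite_V c, of "\<lambda>v. Y v \<omega>"] by (simp add: C_def A_def X_def)
  have sum_L: "(\<Sum>j\<in>C. L j) = real b * T"
    using sum_over_color_classes[OF finite_V c, of "\<lambda>v. expectation (\<lambda>\<omega>. (Y v \<omega>)\<^sup>2)"]
    by (simp add: C_def A_def L_def T_def mult.left_commute flip: sum_distrib_left)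
  have A_sub: "A j \<subseteq> V" for j by (auto simp: A_def)
  have int_X: "integrable M (\<lambda>\<omega>. exp (u * X j \<omega> - L j))" for j
    using integrable_exp_sum[OF A_sub \<open>0 \<le> u\<close>] by (simp add: X_def exp_diff)
  have mgf_X: "expectation (\<lambda>\<omega>. exp (u * X j \<omega> - L j)) \<le> 1" for j
  proof -
    have "expectation (\<lambda>\<omega>. exp (u * X j \<omega>)) \<le> exp (L j)"
      unfolding X_def L_def using c \<open>0 \<le> u\<close>
      by (intro bennett_mgf_nonadjacent) (auto simp: A_def fold_coloring_def)
    then show ?thesis by (simp add: exp_diff)
  qed
  have avg: "exp (u * real b / real a * (\<Sum>v\<in>V. Y v \<omega>) - real b / real a * T)
      \<le> (\<Sum>j\<in>C. exp (u * X j \<omega> - L j)) / real a" for \<omega>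
  proof -
    have "(\<Sum>j\<in>C. u * X j \<omega> - L j) / real a
        = u * real b / real a * (\<Sum>v\<in>V. Y v \<omega>) - real b / real a * T"
      by (simp add: sum_subtractf sum_X sum_L diff_divide_distrib flip: sum_distrib_left)
    then show ?thesis
      using exp_average_le[OF C, of "\<lambda>j. u * X j \<omega> - L j"] by (simp add: a)
  qed
  have "0 \<le> u * real b / real a" using \<open>0 \<le> u\<close> by simp
  from integrable_exp_sum[OF subset_refl this]
  have int_total:
    "integrable M (\<lambda>\<omega>. exp (u * real b / real a * (\<Sum>v\<in>V. Y v \<omega>) - real b / real a * T))"
    unfolding exp_diff by (intro integrable_divide_zero) simp
  have "expectation (\<lambda>\<omega>. exp (u * real b / real a * (\<Sum>v\<in>V. Y v \<omega>) - real b / real a * T))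
      \<le> expectation (\<lambda>\<omega>. (\<Sum>j\<in>C. exp (u * X j \<omega> - L j)) / real a)"
    using int_X by (intro integral_mono[OF int_total _ avg]) simp
  also have "\<dots> = (\<Sum>j\<in>C. expectation (\<lambda>\<omega>. exp (u * X j \<omega> - L j))) / real a"
    using int_X by (simp add: Bochner_Integration.integral_sum)
  also have "\<dots> \<le> 1"
    using sum_bounded_above[of C _ "1::real", OF mgf_X] \<open>0 < real a\<close> by (simp add: a)
  finally show ?thesis
    by (simp add: exp_diff T_def)
qed

text \<open>Markov's inequality for \<open>exp (u b/a \<Sum>Y)\<close> bounds the tail by
  \<open>exp (- b/a (u t - (exp u - 1 - u) S))\<close>. The concave function \<open>u t - (exp u - 1 - u) S\<close>
  of \<open>u\<close> is largest where its derivative \<open>t - (exp u - 1) S\<close> vanishes, that is at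
  \<open>u = ln (1 + t/S)\<close>, and its maximum is \<open>S psi (t/S)\<close>.\<close>

lemma bennett_tail_fold_coloring:
  assumes c: "fold_coloring V E b c" and ne: "(\<Union>v\<in>V. c v) \<noteq> {}" and "0 < b"
    and S: "S = (\<Sum>v\<in>V. expectation (\<lambda>\<omega>. (Y v \<omega>)\<^sup>2))" and "0 < S" and "0 < t"
  defines "a \<equiv> card (\<Union>v\<in>V. c v)"
  shows "prob {\<omega> \<in> space M. (\<Sum>v\<in>V. Y v \<omega>) \<ge> t} \<le> exp (- (S * psi (t / S)) / (real a / real b))"
proof -
  define u where "u = ln (1 + t / S)"
  have "0 < u" unfolding u_def using \<open>0 < S\<close> \<open>0 < t\<close> by (intro ln_gt_zero) simp
  have "exp u = 1 + t / S" using \<open>0 < S\<close> \<open>0 < t\<close> by (simp add: u_def add_pos_pos)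
  then have psi: "u * t - (exp u - 1 - u) * S = S * psi (t / S)"
    using \<open>0 < S\<close> by (simp add: psi_def u_def field_simps)
  have "finite (\<Union>v\<in>V. c v)"
    using c finite_V by (auto simp: fold_coloring_def)
  then have "0 < a" using ne by (simp add: a_def card_gt_0_iff)
  define s where "s = u * real b / real a"
  have "0 < s" using \<open>0 < u\<close> \<open>0 < a\<close> \<open>0 < b\<close> by (simp add: s_def)
  have int: "integrable M (\<lambda>\<omega>. exp (s * (\<Sum>v\<in>V. Y v \<omega>)))"
    using \<open>0 < s\<close> by (intro integrable_exp_sum) auto
  have "prob {\<omega> \<in> space M. (\<Sum>v\<in>V. Y v \<omega>) \<ge> t}
      \<le> exp (- s * t) * (\<integral>\<omega>\<in>space M. exp (s * (\<Sum>v\<in>V. Y v \<omega>)) \<partial>M)"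
    using \<open>0 < s\<close> integrable_mult_indicator[OF sets.top int]
    by (intro Chernoff_ineq_ge) (simp_all add: set_integrable_def)
  also have "(\<integral>\<omega>\<in>space M. exp (s * (\<Sum>v\<in>V. Y v \<omega>)) \<partial>M)
      = expectation (\<lambda>\<omega>. exp (s * (\<Sum>v\<in>V. Y v \<omega>)))"
    by (rule set_integral_space[OF int])
  also have "exp (- s * t) * \<dots> \<le> exp (- s * t) * exp (real b / real a * ((exp u - 1 - u) * S))"
    using bennett_mgf_fold_coloring[OF c ne, of u] \<open>0 < u\<close>
    by (intro mult_left_mono) (simp_all add: s_def a_def S)
  also have "\<dots> = exp (- (real b / real a) * (u * t - (exp u - 1 - u) * S))"
    by (simp add: s_def algebra_simps add_divide_distrib flip: exp_add)
  also have "\<dots> = exp (- (S * psi (t / S)) / (real a / real b))"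
    unfolding psi by (simp add: mult.commute)
  finally show ?thesis .
qed

end

section \<open>The infimum over all multiplicities\<close>

text \<open>Giving each vertex its own block of \<open>b\<close> colors is always a coloring, so the least number of
  colors is attained rather than an unspecified value.\<close>

lemma fold_colorable_fold_chromatic_number:
  assumes "finite V" and "loopless_graph V E"
  shows "fold_colorable V E (fold_chromatic_number V E b) b"
proof -
  obtain f :: "'a \<Rightarrow> nat" where f: "inj_on f V"
    using finite_imp_inj_to_nat_seg[OF \<open>finite V\<close>] by blast
  define c where "c v = (\<lambda>i. f v * b + i) ` {..<b}" for v
  have "c u \<inter> c v = {}" if "u \<in> V" "v \<in> V" "{u, v} \<in> E" for u v
  proof -
    have "u \<noteq> v"
      using \<open>loopless_graph V E\<close> that(3) by (auto simp: loopless_graph_def doubleton_eq_iff)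
    then have "f u \<noteq> f v"
      using f that by (auto dest: inj_onD)
    moreover have "x div b = f w" if "x \<in> c w" for x w
      using that by (auto simp: c_def)
    ultimately show ?thesis by (metis disjoint_iff)
  qed
  moreover have "finite (c v) \<and> card (c v) = b" for v
    by (simp add: c_def card_image)
  ultimately have "fold_coloring V E b c"
    by (simp add: fold_coloring_def)
  then have "fold_colorable V E (card (\<Union>v\<in>V. c v)) b"
    by (auto simp: fold_colorable_def)
  then show ?thesis
    unfolding fold_chromatic_number_def by (rule LeastI)
qed

lemma fold_coloring_le_card:
  assumes "fold_coloring V E b c" and "finite V" and "V \<noteq> {}"
  shows "b \<le> card (\<Union>v\<in>V. c v)"
proof -
  obtain v where "v \<in> V" using \<open>V \<noteq> {}\<close> by blast
  have "card (c v) \<le> card (\<Union>v\<in>V. c v)"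
    using assms \<open>v \<in> V\<close> by (intro card_mono) (auto simp: fold_coloring_def)
  then show ?thesis
    using assms \<open>v \<in> V\<close> by (simp add: fold_coloring_def)
qed

text \<open>Cleared of its denominator, each bound reads \<open>K \<le> r b * - ln p\<close>, so for \<open>p < 1\<close> the number
  \<open>K / - ln p\<close> is a lower bound of all \<open>r b\<close>, hence of their infimum. The uniform bound \<open>d\<close> keeps
  the infimum positive, so that one can divide by it again.\<close>

lemma le_exp_INF:
  fixes p K d :: real and r :: "'b \<Rightarrow> real"
  assumes "B \<noteq> {}" and "0 < d" and "\<And>b. b \<in> B \<Longrightarrow> d \<le> r b"
    and "\<And>b. b \<in> B \<Longrightarrow> p \<le> exp (- K / r b)"
  shows "p \<le> exp (- K / (INF b\<in>B. r b))"
proof (cases "0 < p")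
  case False
  then show ?thesis by (meson exp_ge_zero linorder_not_less order_trans)
next
  case True
  have inf: "d \<le> (INF b\<in>B. r b)"
    using assms by (intro cINF_greatest)
  have bdd: "bdd_below (r ` B)"
    using assms(3) by (rule bdd_belowI2)
  have key: "K \<le> r b * - ln p" if "b \<in> B" for b
  proof -
    have "ln p \<le> - K / r b"
      using assms(4)[OF that] True by (metis exp_le_cancel_iff exp_ln)
    moreover have "0 < r b" using assms(2) assms(3)[OF that] by simp
    ultimately show ?thesis by (simp add: field_simps)
  qed
  have "K \<le> (INF b\<in>B. r b) * - ln p"
  proof (cases "ln p < 0")
    case True
    then have pos: "0 < - ln p" by simp
    have "K / - ln p \<le> (INF b\<in>B. r b)"
      using \<open>B \<noteq> {}\<close> key[folded pos_divide_le_eq[OF pos]] by (rule cINF_greatest)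
    then show ?thesis unfolding pos_divide_le_eq[OF pos] .
  next
    case False
    \<comment> \<open>Now \<open>- ln p \<le> 0\<close>, and decreasing \<open>r b\<close> to the infimum only weakens a single bound.\<close>
    obtain b where "b \<in> B" using \<open>B \<noteq> {}\<close> by blast
    then have "(INF b\<in>B. r b) \<le> r b" using bdd by (rule cINF_lower[rotated])
    then have "r b * - ln p \<le> (INF b\<in>B. r b) * - ln p"
      using False by (intro mult_right_mono_neg) auto
    with key[OF \<open>b \<in> B\<close>] show ?thesis by linarith
  qed
  then have "ln p \<le> - K / (INF b\<in>B. r b)"
    using inf \<open>0 < d\<close> by (simp add: field_simps)
  with True show ?thesis by (metis exp_le_cancel_iff exp_ln)
qed

theorem theorem2p4:
  fixes M :: "'w measure" and V :: "'v set" and E :: "'v set set"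
    and Y :: "'v \<Rightarrow> 'w \<Rightarrow> real" and S t :: real
  assumes "prob_space M"
    and "finite V"
    and "\<And>v. v \<in> V \<Longrightarrow> Y v \<in> borel_measurable M"
    and "dependency_graph M V E Y"
    and "\<And>v. v \<in> V \<Longrightarrow> AE \<omega> in M. Y v \<omega> \<le> 1"
    and "\<And>v. v \<in> V \<Longrightarrow> integrable M (Y v)"
    and "\<And>v. v \<in> V \<Longrightarrow> prob_space.expectation M (Y v) = 0"
    and "\<And>v. v \<in> V \<Longrightarrow> integrable M (\<lambda>\<omega>. (Y v \<omega>)\<^sup>2)"
    and "S = (\<Sum>v\<in>V. prob_space.variance M (Y v))"
    and "0 < S"
    and "0 < t"
  shows "prob_space.prob M {\<omega> \<in> space M. (\<Sum>v\<in>V. Y v \<omega>) \<ge> t}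
    \<le> exp (- (S / fractional_chromatic_number V E) * psi (t / S))"
proof -
  interpret prob_space M by fact
  interpret bennett_family M V E Y
    using assms(2-8) by unfold_locales auto
  define k where "k b = fold_chromatic_number V E b" for b
  have S: "S = (\<Sum>v\<in>V. expectation (\<lambda>\<omega>. (Y v \<omega>)\<^sup>2))"
    using assms(7,9) by simp
  have "V \<noteq> {}" using \<open>0 < S\<close> S by auto
  have ratio: "1 \<le> real (k b) / real b
      \<and> prob {\<omega> \<in> space M. (\<Sum>v\<in>V. Y v \<omega>) \<ge> t} \<le> exp (- (S * psi (t / S)) / (real (k b) / real b))"
    if "b \<in> {1..}" for b
  proof -
    have "0 < b" using that by simp
    have "loopless_graph V E" using dep by (simp add: dependency_graph_def)
    then obtain c where c: "fold_coloring V E b c" "card (\<Union>v\<in>V. c v) = k b"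
      using fold_colorable_fold_chromatic_number[OF finite_V, of E b]
      by (auto simp: k_def fold_colorable_def)
    have "b \<le> k b"
      using fold_coloring_le_card[OF c(1) finite_V \<open>V \<noteq> {}\<close>] c(2) by simp
    moreover from this have "(\<Union>v\<in>V. c v) \<noteq> {}"
      using \<open>0 < b\<close> c(2) by (metis card.empty not_le)
    ultimately show ?thesis
      using bennett_tail_fold_coloring[OF c(1) _ \<open>0 < b\<close> S \<open>0 < S\<close> \<open>0 < t\<close>] c(2) \<open>0 < b\<close>
      by (simp add: le_divide_eq)
  qed
  have "prob {\<omega> \<in> space M. (\<Sum>v\<in>V. Y v \<omega>) \<ge> t}
      \<le> exp (- (S * psi (t / S)) / (INF b\<in>{1..}. real (k b) / real b))"
    using ratio by (intro le_exp_INF[where d = 1]) auto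
  then show ?thesis
    by (simp add: fractional_chromatic_number_def k_def)
qed

end
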